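(* Let $n\ge 2$. (1) Let $A_0\in\mathbb{C}^{n\times n}$ be traceless, i.e. $\operatorname{tr}A_0=0$, and let $\lambda_1,\ldots,\lambda_n$ be the eigenvalues of $A_0$, counted by multiplicity as roots of the characteristic polynomial. Put $\mathcal{Q}(A_0)=\operatorname{tr}(A_0^2)$. Then the convex hull of the spectrum of $A_0$ contains an ellipse $E(A_0)$ with foci $$\pm\frac{1}{\sqrt2\,(n-1)}\sqrt{\mathcal{Q}(A_0)}$$ and with the sum of squares of its semiaxes equal to $$\left(\frac{1}{\sqrt2\,(n-1)}\right)^2\sum_{i=1}^n|\lambda_i|^2 .$$ Moreover, if $\mathcal{Q}(A_0)\neq 0$, then the semiaxes of this ellipse are: the semimajor axis $$\frac{1}{\sqrt2\,(n-1)}\sqrt{\sum_{i=1}^n\left(\operatorname{Re}\left(\lambda_i\left(\frac{\mathcal{Q}(A_0)}{|\mathcal{Q}(A_0)|}\right)^{-1/2}\right)\right)^2}$$ and the semiminor axis $$\frac{1}{\sqrt2\,(n-1)}\sqrt{\sum_{i=1}^n\left(\operatorname{Im}\left(\lambda_i\left(\frac{\mathcal{Q}(A_0)}{|\mathcal{Q}(A_0)|}\right)^{-1/2}\right)\right)^2}.$$ (2) Consequently, let $A\in\mathbb{C}^{n\times n}$ be arbitrary and write $A=\gamma\mathbf{I}+A_0$ with $\gamma=\frac1n\operatorname{tr}A\in\mathbb{C}$ and $\operatorname{tr}A_0=0$. Then the convex hull of the spectrum of $A$ contains the shifted ellipse $\gamma+E(A_0)$, which has foci $\gamma\pm\frac{1}{\sqrt2\,(n-1)}\sqrt{\mathcal{Q}(A_0)}$,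 where $E(A_0)$ is the ellipse from (1). The convex hull of the spectrum of $A$ also contains the analogous ellipse for any $A$-invariant subspace $V\subseteq\mathbb{C}^n$ of dimension $m\ge 2$, i.e. the ellipse obtained by applying the preceding construction, with $n$ replaced by $m$, to an $m\times m$ matrix representing the restriction $A|_V$.
   Context: $\mathbb{C}^{n\times n}$ is the set of $n\times n$ complex matrices and $\mathbf{I}$ is the unit matrix. $\mathcal{Q}(A):=\operatorname{tr}(A^2)$ is the sum of the squares of the eigenvalues of $A$ (counted by multiplicity in the characteristic polynomial); it is a complex quadratic form, not a Hermitian form, and it is invariant under similarity. Square roots of complex numbers are either of the two roots, fixed once; the pair of foci and the semiaxes do not depend on the choice. "Ellipse" means the closed filled region in $\mathbb{C}\cong\mathbb{R}^2$: for $f_1,f_2\in\mathbb{C}$ and real numbers $a\ge b\ge 0$ with $a^2-b^2=\frac14|f_1-f_2|^2$, the ellipse with foci $f_1,f_2$, semimajor axis $a$ and semiminor axis $b$ is $\{z\in\mathbb{C}:|z-f_1|+|z-f_2|\le 2a\}$. Degenerate cases are allowed: $b=0$ gives the segment $[f_1,f_2]$ (or a point), and $f_1=f_2$ gives a disk. The ellipse is determined by its foci and the sum $a^2+b^2$ of squares of its semiaxes. *)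

theory Defs
  imports "HOL-Analysis.Analysis" "Jordan_Normal_Form.Spectral_Radius" "Jordan_Normal_Form.VS_Connect"
begin

text \<open>Filled, possibly degenerate ellipses in the complex plane. If
  \<open>b = 0\<close> the set is the segment between the foci, if \<open>f1 = f2\<close> it is a disk.\<close>

definition is_ellipse :: "complex set \<Rightarrow> complex \<Rightarrow> complex \<Rightarrow> real \<Rightarrow> real \<Rightarrow> bool" where
  "is_ellipse E f1 f2 a b \<longleftrightarrow>
     0 \<le> b \<and> b \<le> a \<and> a\<^sup>2 - b\<^sup>2 = (cmod (f1 - f2))\<^sup>2 / 4 \<and>
     E = {z. cmod (z - f1) + cmod (z - f2) \<le> 2 * a}"

definition mat_trace :: "complex mat \<Rightarrow> complex" where
  "mat_trace A = (\<Sum>i<dim_row A. A $$ (i, i))"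

definition tr_sq :: "complex mat \<Rightarrow> complex" where
  "tr_sq A = mat_trace (A * A)"

definition eigvals_mset :: "complex mat \<Rightarrow> complex multiset" where
  "eigvals_mset A = proots (char_poly A)"

definition ell_scale :: "nat \<Rightarrow> real" where
  "ell_scale n = 1 / (sqrt 2 * (real n - 1))"

text \<open>\<open>E\<close> is the ellipse with centre \<open>c\<close>, semiaxes \<open>a\<close>, \<open>b\<close>, and with the foci and the sum of
  squares of the semiaxes prescribed by \<open>A\<close>. The quantifier over \<open>r\<close> covers both square roots
  of \<open>tr_sq A\<close>.\<close>

definition is_trace_ellipse ::
  "complex mat \<Rightarrow> complex \<Rightarrow> complex set \<Rightarrow> real \<Rightarrow> real \<Rightarrow> bool" where
  "is_trace_ellipse A c E a b \<longleftrightarrow>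
     (\<forall>r. r\<^sup>2 = tr_sq A \<longrightarrow>
        is_ellipse E (c + of_real (ell_scale (dim_row A)) * r)
                     (c - of_real (ell_scale (dim_row A)) * r) a b) \<and>
     a\<^sup>2 + b\<^sup>2 = (ell_scale (dim_row A))\<^sup>2 * (\<Sum>x\<in>#eigvals_mset A. (cmod x)\<^sup>2)"

text \<open>Foci and sum of squares of the semiaxes determine the ellipse, so there is at most one
  such set; that there is one at all is a property of \<open>A\<close>.\<close>

definition trace_ellipse :: "complex mat \<Rightarrow> complex set" where
  "trace_ellipse A = (THE E. \<exists>a b. is_trace_ellipse A 0 E a b)"

lemma is_ellipse_unique:
  assumes "is_ellipse E f1 f2 a b" "is_ellipse E' f1 f2 a' b'" "a\<^sup>2 + b\<^sup>2 = a'\<^sup>2 + b'\<^sup>2"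
  shows "E = E' \<and> a = a' \<and> b = b'"
proof -
  have "a\<^sup>2 - b\<^sup>2 = a'\<^sup>2 - b'\<^sup>2"
    and pos: "0 \<le> a" "0 \<le> a'" "0 \<le> b" "0 \<le> b'"
    using assms(1,2) unfolding is_ellipse_def by auto
  then have "a\<^sup>2 = a'\<^sup>2" "b\<^sup>2 = b'\<^sup>2"
    using assms(3) by linarith+
  then have "a = a'" "b = b'" by (metis pos power2_eq_imp_eq)+
  then show ?thesis using assms unfolding is_ellipse_def by simp
qed

lemma trace_ellipse_eq:
  assumes "is_trace_ellipse A 0 E a b"
  shows "trace_ellipse A = E"
  unfolding trace_ellipse_def
proof (rule the_equality)
  fix E' assume "\<exists>a b. is_trace_ellipse A 0 E' a b"
  then obtain a' b' where E': "is_trace_ellipse A 0 E' a' b'" by blast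
  have "(csqrt (tr_sq A))\<^sup>2 = tr_sq A" by simp
  then show "E' = E"
    using assms E' is_ellipse_unique unfolding is_trace_ellipse_def by metis
qed (use assms in blast)

definition traceless_decomp :: "nat \<Rightarrow> complex mat \<Rightarrow> complex \<Rightarrow> complex mat \<Rightarrow> bool" where
  "traceless_decomp n A \<gamma> A0 \<longleftrightarrow>
     \<gamma> = mat_trace A / of_nat n \<and> A0 \<in> carrier_mat n n \<and> mat_trace A0 = 0 \<and>
     A = \<gamma> \<cdot>\<^sub>m 1\<^sub>m n + A0"

lemma traceless_decomp_exists:
  assumes "A \<in> carrier_mat n n" "n > 0"
  shows "traceless_decomp n A (mat_trace A / of_nat n) (A - (mat_trace A / of_nat n) \<cdot>\<^sub>m 1\<^sub>m n)"
  using assms unfolding traceless_decomp_def mat_trace_def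
  by (auto simp: sum_subtractf intro!: eq_matI)

definition subspace_module :: "nat \<Rightarrow> complex vec set \<Rightarrow> (complex, complex vec) module" where
  "subspace_module n V = (module_vec TYPE(complex) n)\<lparr>carrier := V\<rparr>"

definition invariant_subspace :: "nat \<Rightarrow> complex mat \<Rightarrow> complex vec set \<Rightarrow> bool" where
  "invariant_subspace n A V \<longleftrightarrow>
     VectorSpace.subspace class_ring V (module_vec TYPE(complex) n) \<and> (\<forall>v\<in>V. A *\<^sub>v v \<in> V)"

text \<open>\<open>B\<close> is the matrix of the restriction of \<open>A\<close> to \<open>V\<close> in some ordered basis \<open>bs\<close> of \<open>V\<close>:
  the coordinates of \<open>A *\<^sub>v bs ! j\<close> are the \<open>j\<close>-th column of \<open>B\<close>.\<close>

definition represents_restriction ::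
  "nat \<Rightarrow> complex mat \<Rightarrow> complex vec set \<Rightarrow> complex mat \<Rightarrow> bool" where
  "represents_restriction n A V B \<longleftrightarrow>
     (\<exists>bs. distinct bs \<and> vectorspace.basis class_ring (subspace_module n V) (set bs) \<and>
           B \<in> carrier_mat (length bs) (length bs) \<and>
           A * mat_of_cols n bs = mat_of_cols n bs * B)"

text \<open>Every invariant subspace admits such a matrix, so quantifying over all of them is not
  vacuous.\<close>

lemma represents_restriction_exists:
  assumes A: "A \<in> carrier_mat n n" and inv: "invariant_subspace n A V"
  defines "m \<equiv> vectorspace.dim class_ring (subspace_module n V)"
  shows "\<exists>B\<in>carrier_mat m m. represents_restriction n A V B"
proof -
  interpret vs: vec_space "TYPE(complex)" n .
  have sub: "VectorSpace.subspace class_ring V (module_vec TYPE(complex) n)"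
    and closed: "\<And>v. v \<in> V \<Longrightarrow> A *\<^sub>v v \<in> V"
    using inv unfolding invariant_subspace_def by auto
  have submod: "submodule class_ring V (module_vec TYPE(complex) n)"
    using sub by (simp add: VectorSpace.subspace_def)
  have Vsub: "V \<subseteq> carrier_vec n"
    using submod unfolding submodule_def by (auto simp: module_vec_simps)
  have W: "vectorspace class_ring (subspace_module n V)"
    unfolding subspace_module_def by (rule vs.subspace_is_vs[OF sub])
  interpret w: vectorspace class_ring "subspace_module n V" by (rule W)
  have carr: "carrier (subspace_module n V) = V"
    by (simp add: subspace_module_def)
  have li: "w.lin_dep S = vs.lin_dep S" and sp: "w.span S = vs.span S" if "S \<subseteq> V" for S
    unfolding subspace_module_def
    using vs.span_li_not_depend[OF that submod] by auto
  have bound: "finite S \<and> card S \<le> n" if "S \<subseteq> V" "w.lin_indpt S" for S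
    using vs.li_le_dim[of S] that li[OF that(1)] Vsub vs.dim_is_n vs.fin_dim by auto
  have "w.lin_indpt {}" by (simp add: w.lin_dep_def)
  then obtain \<beta> where "finite \<beta>" and max: "maximal \<beta> (\<lambda>S. S \<subseteq> V \<and> w.lin_indpt S)"
    using maximal_exists[where P = "\<lambda>S. S \<subseteq> V \<and> w.lin_indpt S" and N = n and B = "{}"] bound by auto
  have \<beta>V: "\<beta> \<subseteq> V" and \<beta>li: "w.lin_indpt \<beta>" using max unfolding maximal_def by auto
  have gen: "w.span \<beta> = V" using w.max_li_is_gen[of \<beta>] max unfolding carr by blast
  have basis: "w.basis \<beta>" unfolding w.basis_def carr using gen \<beta>V \<beta>li by blast
  obtain bs where bs: "set bs = \<beta>" "distinct bs"
    using finite_distinct_list[OF \<open>finite \<beta>\<close>] by blast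
  have len: "length bs = m"
    unfolding m_def w.dim_basis[OF \<open>finite \<beta>\<close> basis] bs(1)[symmetric]
    by (rule distinct_card[OF bs(2), symmetric])
  define P where "P = mat_of_cols n bs"
  have P: "P \<in> carrier_mat n m" unfolding P_def len[symmetric] by simp
  have bsn: "set bs \<subseteq> carrier_vec n" using bs \<beta>V Vsub by simp
  have "V = vs.col_space P"
    unfolding vs.col_space_def P_def cols_mat_of_cols[OF bsn] bs(1) using gen sp[OF \<beta>V] by argo
  also have "\<dots> = {y \<in> carrier_vec n. \<exists>x\<in>carrier_vec m. P *\<^sub>v x = y}"
    using vs.col_space_eq[OF P] P by simp
  finally have Veq: "V = {y \<in> carrier_vec n. \<exists>x\<in>carrier_vec m. P *\<^sub>v x = y}" .
  have "\<forall>j. \<exists>x. j < m \<longrightarrow> x \<in> carrier_vec m \<and> P *\<^sub>v x = A *\<^sub>v (bs ! j)"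
  proof (intro allI)
    fix j
    have "A *\<^sub>v (bs ! j) \<in> V" if "j < m"
      using closed \<beta>V bs nth_mem that len by blast
    then show "\<exists>x. j < m \<longrightarrow> x \<in> carrier_vec m \<and> P *\<^sub>v x = A *\<^sub>v (bs ! j)"
      using Veq by blast
  qed
  then obtain x where x: "\<And>j. j < m \<Longrightarrow> x j \<in> carrier_vec m \<and> P *\<^sub>v x j = A *\<^sub>v (bs ! j)"
    by metis
  define B where "B = mat_of_cols m (map x [0..<m])"
  have B: "B \<in> carrier_mat m m" 
    using mat_of_cols_carrier(1)[of m "map x [0..<m]"] unfolding B_def by simp
  have "A * P = P * B"
  proof (rule mat_col_eqI)
    fix j assume "j < dim_col (P * B)"
    then have j: "j < m" using B by simp
    have "col (A * P) j = A *\<^sub>v col P j" by (rule col_mult2[OF A P j])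
    also have "col P j = bs ! j"
      unfolding P_def using j len bsn nth_mem by (intro col_mat_of_cols) auto
    also have "A *\<^sub>v (bs ! j) = P *\<^sub>v x j" using x[OF j] by simp
    also have "x j = col B j"
      unfolding B_def using j x[OF j] by (subst col_mat_of_cols) auto
    also have "P *\<^sub>v col B j = col (P * B) j" by (rule col_mult2[OF P B j, symmetric])
    finally show "col (A * P) j = col (P * B) j" .
  qed (use A P B in auto)
  then show ?thesis
    unfolding represents_restriction_def using B basis bs len P_def by (intro bexI[of _ B]) auto
qed

end

theory Submission
  imports Defs "Jordan_Normal_Form.DL_Rank"
begin

text \<open>With \<open>Q = tr_sq A\<close>, \<open>w\<^sup>2 = Q / \<bar>Q\<bar>\<close> and \<open>s = 1 / (\<surd>2 (n - 1))\<close>, the ellipse lies in the half plane \<open>Re (v z) \<le> L\<close>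
  as soon as \<open>s\<^sup>2 \<Sum> (Re (v \<lambda>\<^sub>i))\<^sup>2 \<le> L\<^sup>2\<close>: turning by \<open>w\<close> brings the foci to the real axis and
  kills the mixed term of this quadratic form in \<open>v\<close>, so that it becomes the square of the support
  function. If the half plane contains all eigenvalues, then the \<open>Re (v \<lambda>\<^sub>i)\<close> are \<open>n\<close> reals with
  sum \<open>0\<close> bounded by \<open>L\<close>, hence \<open>\<Sum> (Re (v \<lambda>\<^sub>i))\<^sup>2 \<le> n (n - 1) L\<^sup>2 \<le> 2 (n - 1)\<^sup>2 L\<^sup>2\<close>. A point of the ellipse
  outside the convex hull would be separated from the spectrum by such a half plane.\<close>

section \<open>Inequalities for sums of reals over multisets\<close>

lemma sum_mset_nonneg_real:
  fixes f :: "'a \<Rightarrow> real"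
  assumes "\<And>x. x \<in># M \<Longrightarrow> 0 \<le> f x"
  shows "0 \<le> (\<Sum>x\<in>#M. f x)"
  using assms by (induction M) (auto intro!: add_nonneg_nonneg)

lemma sum_mset_le_size_mult:
  fixes f :: "'a \<Rightarrow> real"
  assumes "\<And>x. x \<in># M \<Longrightarrow> f x \<le> L"
  shows "(\<Sum>x\<in>#M. f x) \<le> real (size M) * L"
  using assms by (induction M) (auto simp: distrib_right intro!: add_mono)

text \<open>Expanding the square of the sum leaves, besides the squares, only products of two
  nonnegative terms.\<close>

lemma sum_mset_squares_le_square_sum:
  fixes f :: "'a \<Rightarrow> real"
  assumes "\<And>x. x \<in># M \<Longrightarrow> 0 \<le> f x"
  shows "(\<Sum>x\<in>#M. (f x)\<^sup>2) \<le> (\<Sum>x\<in>#M. f x)\<^sup>2"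
  using assms
proof (induction M)
  case (add x M)
  then have "0 \<le> f x" "0 \<le> (\<Sum>x\<in>#M. f x)" by (auto intro: sum_mset_nonneg_real)
  then have "0 \<le> 2 * f x * (\<Sum>x\<in>#M. f x)" by (intro mult_nonneg_nonneg) auto
  then show ?case using add by (simp add: power2_sum)
qed simp

text \<open>With \<open>y = L - f x\<close>, which is nonnegative of total \<open>size M * L\<close>, this is
  \<open>\<Sum> y\<^sup>2 \<le> (\<Sum> y)\<^sup>2\<close>.\<close>

lemma sum_mset_squares_le_of_upper_bound:
  fixes f :: "'a \<Rightarrow> real"
  assumes le: "\<And>x. x \<in># M \<Longrightarrow> f x \<le> L" and zero: "(\<Sum>x\<in>#M. f x) = 0"
  shows "(\<Sum>x\<in>#M. (f x)\<^sup>2) \<le> real (size M) * (real (size M) - 1) * L\<^sup>2"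
proof -
  have s1: "(\<Sum>x\<in>#M. L - f x) = real (size M) * L - (\<Sum>x\<in>#M. f x)" for M :: "'a multiset"
    by (induction M) (auto simp: algebra_simps)
  have s2: "(\<Sum>x\<in>#M. (L - f x)\<^sup>2) =
      real (size M) * L\<^sup>2 - 2 * L * (\<Sum>x\<in>#M. f x) + (\<Sum>x\<in>#M. (f x)\<^sup>2)" for M :: "'a multiset"
    by (induction M) (auto simp: algebra_simps power2_eq_square)
  have "(\<Sum>x\<in>#M. (L - f x)\<^sup>2) \<le> (\<Sum>x\<in>#M. L - f x)\<^sup>2"
    using le by (intro sum_mset_squares_le_square_sum) auto
  then show ?thesis
    unfolding s1 s2 zero by (simp add: algebra_simps power2_eq_square)
qed

section \<open>The support function of an ellipse\<close>

text \<open>The roots are removed by squaring twice: the first squaring isolates the product of the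
  focal distances, and in the second the square of \<open>x\<^sup>2 + y\<^sup>2 + c\<^sup>2\<close>
  cancels. The bound on \<open>x\<close> is recorded separately because for \<open>b = 0\<close> the
  quadratic inequality says nothing about \<open>x\<close>.\<close>

lemma ellipse_equation:
  fixes a b c x y :: real
  assumes ab: "0 \<le> a" and b2: "b\<^sup>2 = a\<^sup>2 - c\<^sup>2"
    and foc: "sqrt ((x - c)\<^sup>2 + y\<^sup>2) + sqrt ((x + c)\<^sup>2 + y\<^sup>2) \<le> 2 * a"
  shows "b\<^sup>2 * x\<^sup>2 + a\<^sup>2 * y\<^sup>2 \<le> a\<^sup>2 * b\<^sup>2" "x\<^sup>2 \<le> a\<^sup>2"
proof -
  define d e where "d = sqrt ((x - c)\<^sup>2 + y\<^sup>2)" and "e = sqrt ((x + c)\<^sup>2 + y\<^sup>2)"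
  have d: "d \<ge> 0" "d\<^sup>2 = (x - c)\<^sup>2 + y\<^sup>2" and e: "e \<ge> 0" "e\<^sup>2 = (x + c)\<^sup>2 + y\<^sup>2"
    by (auto simp: d_def e_def)
  \<comment> \<open>\<open>x\<close> is the mean of \<open>x - c\<close> and \<open>x + c\<close>,
    hence bounded by half the sum of the focal distances.\<close>
  have "\<bar>x - c\<bar> \<le> d" "\<bar>x + c\<bar> \<le> e" unfolding d_def e_def by (auto intro: real_le_rsqrt)
  then have "\<bar>x\<bar> \<le> a" using foc unfolding d_def[symmetric] e_def[symmetric] by linarith
  then show "x\<^sup>2 \<le> a\<^sup>2" using abs_le_square_iff[of x a] by simp
  have "(d + e)\<^sup>2 \<le> (2 * a)\<^sup>2"
    using foc d e unfolding d_def[symmetric] e_def[symmetric] by (intro power_mono) auto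
  then have "d * e \<le> 2 * a\<^sup>2 - (x\<^sup>2 + y\<^sup>2 + c\<^sup>2)"
    using d e by (simp add: power2_eq_square algebra_simps)
  then have "(d * e)\<^sup>2 \<le> (2 * a\<^sup>2 - (x\<^sup>2 + y\<^sup>2 + c\<^sup>2))\<^sup>2"
    using d e by (intro power_mono) auto
  then have "((x - c)\<^sup>2 + y\<^sup>2) * ((x + c)\<^sup>2 + y\<^sup>2) \<le> (2 * a\<^sup>2 - (x\<^sup>2 + y\<^sup>2 + c\<^sup>2))\<^sup>2"
    by (simp add: power_mult_distrib d e)
  then show "b\<^sup>2 * x\<^sup>2 + a\<^sup>2 * y\<^sup>2 \<le> a\<^sup>2 * b\<^sup>2"
    unfolding b2 by (simp add: power2_eq_square algebra_simps)
qed

text \<open>Cauchy-Schwarz for the vectors \<open>(p * a, q * b)\<close> and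
  \<open>(x / a, y / b)\<close>, the latter lying in the unit disk by the ellipse equation. A
  vanishing semiaxis does not allow this scaling and is treated apart.\<close>

lemma ellipse_support_real:
  fixes a b c x y p q :: real
  assumes a: "0 \<le> a" and b: "0 \<le> b" and b2: "b\<^sup>2 = a\<^sup>2 - c\<^sup>2"
    and foc: "sqrt ((x - c)\<^sup>2 + y\<^sup>2) + sqrt ((x + c)\<^sup>2 + y\<^sup>2) \<le> 2 * a"
  shows "(p * x + q * y)\<^sup>2 \<le> a\<^sup>2 * p\<^sup>2 + b\<^sup>2 * q\<^sup>2"
proof -
  note eq = ellipse_equation[OF a b2 foc]
  consider "a = 0" | "a > 0" "b = 0" | "a > 0" "b > 0" using a b by linarith
  then show ?thesis
  proof cases
    case 1
    then have "c = 0" "b = 0" "x = 0"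
      using b2 eq(2) sum_power2_eq_zero_iff[of b c] by auto
    \<comment> \<open>Both foci are at the origin, so the focal inequality reads
      \<open>2 * \<bar>y\<bar> \<le> 0\<close>.\<close>
    moreover from this 1 foc have "y = 0" by simp
    ultimately show ?thesis using 1 by simp
  next
    case 2
    then have "a\<^sup>2 * y\<^sup>2 \<le> 0" using eq(1) by simp
    then have "y = 0" using 2 by (simp add: mult_le_0_iff)
    then show ?thesis using 2 mult_right_mono[OF eq(2), of "p\<^sup>2"]
      by (simp add: power_mult_distrib algebra_simps)
  next
    case 3
    define X Y where "X = x / a" and "Y = y / b"
    have xy: "x = a * X" "y = b * Y" using 3 by (auto simp: X_def Y_def)
    have "a\<^sup>2 * b\<^sup>2 * (X\<^sup>2 + Y\<^sup>2) \<le> a\<^sup>2 * b\<^sup>2 * 1"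
      using eq(1) unfolding xy by (simp add: algebra_simps power_mult_distrib)
    then have "X\<^sup>2 + Y\<^sup>2 \<le> 1" using 3 by (subst (asm) mult_le_cancel_left_pos) auto
    \<comment> \<open>The added square is the one in Lagrange's identity; it turns the right side
      into a product of two sums of squares.\<close>
    have "(p * x + q * y)\<^sup>2 \<le> (p * x + q * y)\<^sup>2 + (p * a * Y - q * b * X)\<^sup>2" by simp
    also have "\<dots> = ((p * a)\<^sup>2 + (q * b)\<^sup>2) * (X\<^sup>2 + Y\<^sup>2)"
      unfolding xy by (simp add: power2_eq_square algebra_simps)
    also have "\<dots> \<le> ((p * a)\<^sup>2 + (q * b)\<^sup>2) * 1"
      using \<open>X\<^sup>2 + Y\<^sup>2 \<le> 1\<close> by (intro mult_left_mono) auto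
    finally have "(p * x + q * y)\<^sup>2 \<le> (p * a)\<^sup>2 + (q * b)\<^sup>2" by simp
    then show ?thesis by (simp add: power_mult_distrib mult.commute)
  qed
qed

text \<open>Multiplication by \<open>cnj w\<close> moves the foci to \<open>c\<close> and
  \<open>- c\<close> on the real axis. With \<open>t = cnj w * z\<close> one has
  \<open>v * z = (v * w) * t\<close>, so the real inequality applies with coefficients
  \<open>Re (v * w)\<close> and \<open>- Im (v * w)\<close>.\<close>

lemma ellipse_support:
  assumes E: "is_ellipse E (of_real c * w) (- (of_real c * w)) a b"
    and w: "cmod w = 1" and z: "z \<in> E"
  shows "(Re (v * z))\<^sup>2 \<le> a\<^sup>2 * (Re (v * w))\<^sup>2 + b\<^sup>2 * (Im (v * w))\<^sup>2"
proof -
  define t where "t = cnj w * z"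
  have ww: "w * cnj w = 1" using complex_norm_square[of w] w by simp
  have zt: "z = w * t" unfolding t_def by (simp add: ww flip: mult.assoc)
  have "cmod (z - of_real c * w) = cmod (w * (t - of_real c))"
    "cmod (z - - (of_real c * w)) = cmod (w * (t + of_real c))"
    unfolding zt by (simp_all add: algebra_simps)
  then have foc: "cmod (t - of_real c) + cmod (t + of_real c) \<le> 2 * a"
    using z E w unfolding is_ellipse_def by (simp add: norm_mult)
  have "cmod (of_real c * w - - (of_real c * w)) = cmod (of_real (2 * c) * w)"
    by (rule arg_cong[of _ _ cmod]) simp
  also have "\<dots> = 2 * \<bar>c\<bar>" using w by (simp only: norm_mult norm_of_real)
  finally have b: "0 \<le> a" "0 \<le> b" "b\<^sup>2 = a\<^sup>2 - c\<^sup>2"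
    using E unfolding is_ellipse_def by auto
  have "(Re (v * w) * Re t + - Im (v * w) * Im t)\<^sup>2 \<le> a\<^sup>2 * (Re (v * w))\<^sup>2 + b\<^sup>2 * (- Im (v * w))\<^sup>2"
    using foc by (intro ellipse_support_real[OF b]) (simp add: cmod_def)
  moreover have "Re (v * z) = Re (v * w) * Re t + - Im (v * w) * Im t"
    unfolding zt mult.assoc[symmetric] times_complex.sel(1)[of "v * w" t] by argo
  ultimately show ?thesis by (simp only: power2_minus)
qed

section \<open>Eigenvalues, trace and trace of the square\<close>

lemma mat_trace_times:
  assumes "X \<in> carrier_mat n n" "Y \<in> carrier_mat n n"
  shows "mat_trace (X * Y) = (\<Sum>i<n. \<Sum>k<n. X $$ (i, k) * Y $$ (k, i))"
  using assms unfolding mat_trace_def by (auto simp: scalar_prod_def atLeast0LessThan)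

text \<open>Schur triangularization: \<open>d\<close> is the diagonal of an upper triangular matrix
  similar to \<open>A\<close>. The characteristic polynomial, the trace and the trace of the square
  are similarity invariants and can be read off that diagonal.\<close>

lemma eigvals_mset_diag:
  assumes A: "A \<in> carrier_mat n n"
  obtains d where "eigvals_mset A = image_mset d (mset_set {..<n})"
    "mat_trace A = (\<Sum>i<n. d i)" "tr_sq A = (\<Sum>i<n. (d i)\<^sup>2)"
proof -
  obtain es where "char_poly A = (\<Prod>a\<leftarrow>es. [:- a, 1:])"
    using char_poly_factorized[OF A] by blast
  from schur_decomposition_exists[OF A this] obtain B
    where B: "B \<in> carrier_mat n n" "upper_triangular B" and sim: "similar_mat A B" by blast
  obtain P Q where wit: "similar_mat_wit A B P Q" using sim unfolding similar_mat_def by blast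
  note PQ = similar_mat_witD2[OF A wit]
  have trace_mult: "mat_trace (X * Y) = mat_trace (Y * X)"
    if X: "X \<in> carrier_mat n n" and Y: "Y \<in> carrier_mat n n" for X Y
    unfolding mat_trace_times[OF X Y] mat_trace_times[OF Y X]
    by (subst sum.swap) (simp add: mult.commute)
  have trace_conj: "mat_trace (P * X * Q) = mat_trace X" if X: "X \<in> carrier_mat n n" for X
  proof -
    have "mat_trace (P * X * Q) = mat_trace (Q * (P * X))"
      using X PQ by (intro trace_mult) auto
    also have "Q * (P * X) = Q * P * X" using X PQ by (intro assoc_mult_mat[symmetric]) auto
    also have "\<dots> = X" using X PQ by simp
    finally show ?thesis .
  qed
  have "char_poly A = (\<Prod>a\<leftarrow>diag_mat B. [:- a, 1:])"
    using char_poly_similar[OF sim] char_poly_upper_triangular[OF B] by simp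
  then have "eigvals_mset A = proots (\<Prod>p\<leftarrow>map (\<lambda>a. [:- a, 1:]) (diag_mat B). p)"
    unfolding eigvals_mset_def by simp
  also have "\<dots> = (\<Sum>p\<leftarrow>map (\<lambda>a. [:- a, 1:]) (diag_mat B). proots p)"
    by (rule proots_prod_list) auto
  also have "\<dots> = mset (diag_mat B)" by (induction "diag_mat B") (auto simp: o_def)
  also have "\<dots> = image_mset (\<lambda>i. B $$ (i, i)) (mset_set {..<n})"
    using B unfolding diag_mat_def by (simp add: atLeast0LessThan)
  finally have 1: "eigvals_mset A = image_mset (\<lambda>i. B $$ (i, i)) (mset_set {..<n})" .
  have 2: "mat_trace A = (\<Sum>i<n. B $$ (i, i))"
    using trace_conj[OF B(1)] PQ B(1) unfolding mat_trace_def by simp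
  have "A * A = P * (B ^\<^sub>m 2) * Q"
    using similar_mat_wit_pow_id[OF wit, of 2] PQ A by (simp add: numeral_2_eq_2)
  then have "tr_sq A = mat_trace (B * B)"
    using trace_conj[of "B * B"] B unfolding tr_sq_def by (simp add: numeral_2_eq_2)
  also have "\<dots> = (\<Sum>i<n. \<Sum>k<n. B $$ (i, k) * B $$ (k, i))"
    by (rule mat_trace_times[OF B(1) B(1)])
  also have "\<dots> = (\<Sum>i<n. (B $$ (i, i))\<^sup>2)"
  proof (intro sum.cong refl)
    fix i assume "i \<in> {..<n}"
    then have i: "i < n" by simp
    \<comment> \<open>For \<open>k \<noteq> i\<close> one of the two entries lies below the diagonal
      and vanishes.\<close>
    have "B $$ (i, k) * B $$ (k, i) = (if k = i then (B $$ (i, i))\<^sup>2 else 0)" if "k < n" for k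
      using upper_triangularD[OF B(2), of i k] upper_triangularD[OF B(2), of k i] B(1) i that
      by (cases k i rule: linorder_cases) (auto simp: power2_eq_square)
    then show "(\<Sum>k<n. B $$ (i, k) * B $$ (k, i)) = (B $$ (i, i))\<^sup>2"
      using i by simp
  qed
  finally show thesis using that 1 2 by blast
qed

lemma size_eigvals_mset: "A \<in> carrier_mat n n \<Longrightarrow> size (eigvals_mset A) = n"
  by (metis eigvals_mset_diag size_image_mset size_mset_set card_lessThan)

lemma sum_eigvals_mset: "A \<in> carrier_mat n n \<Longrightarrow> (\<Sum>x\<in>#eigvals_mset A. x) = mat_trace A"
  by (erule eigvals_mset_diag) (simp add: sum_unfold_sum_mset)

lemma sum_sq_eigvals_mset: "A \<in> carrier_mat n n \<Longrightarrow> (\<Sum>x\<in>#eigvals_mset A. x\<^sup>2) = tr_sq A"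
  by (erule eigvals_mset_diag) (simp add: sum_unfold_sum_mset image_mset.compositionality o_def)

text \<open>The characteristic polynomial is monic, hence nonzero, so the support of its root
  multiset is its zero set.\<close>

lemma set_eigvals_mset:
  assumes A: "A \<in> carrier_mat n n"
  shows "set_mset (eigvals_mset A) = spectrum A"
  using degree_monic_char_poly[OF A] spectrum_root_char_poly[OF A] unfolding eigvals_mset_def
  by (metis coeff_0 set_count_proots zero_neq_one)

section \<open>Spectra of shifts and of restrictions\<close>

text \<open>Adding a scalar matrix keeps the eigenvectors and adds \<open>\<gamma>\<close> to each
  eigenvalue.\<close>

lemma spectrum_traceless_decomp:
  assumes "traceless_decomp n A \<gamma> A0"
  shows "spectrum A = (\<lambda>z. \<gamma> + z) ` spectrum A0"
proof -
  have A0: "A0 \<in> carrier_mat n n" and A: "A = \<gamma> \<cdot>\<^sub>m 1\<^sub>m n + A0"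
    using assms unfolding traceless_decomp_def by blast+
  have dim: "dim_row A = n" "dim_row A0 = n" using A A0 by auto
  have mult: "A *\<^sub>v v = \<gamma> \<cdot>\<^sub>v v + A0 *\<^sub>v v" if "v \<in> carrier_vec n" for v
  proof -
    have "A *\<^sub>v v = (\<gamma> \<cdot>\<^sub>m 1\<^sub>m n) *\<^sub>v v + A0 *\<^sub>v v"
      unfolding A using that A0 by (intro add_mult_distrib_mat_vec[of _ n n]) auto
    also have "(\<gamma> \<cdot>\<^sub>m 1\<^sub>m n) *\<^sub>v v = \<gamma> \<cdot>\<^sub>v v"
      using that by (intro eq_vecI) auto
    finally show ?thesis .
  qed
  have eq: "\<gamma> \<cdot>\<^sub>v v + u = (\<gamma> + k) \<cdot>\<^sub>v v \<longleftrightarrow> u = k \<cdot>\<^sub>v v"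
    if "v \<in> carrier_vec n" "u \<in> carrier_vec n" for u v k
    using that by (auto simp: vec_eq_iff algebra_simps)
  have *: "A *\<^sub>v v = (\<gamma> + k) \<cdot>\<^sub>v v \<longleftrightarrow> A0 *\<^sub>v v = k \<cdot>\<^sub>v v" if "v \<in> carrier_vec n" for v k
    unfolding mult[OF that] using that A0 by (intro eq) auto
  have "eigenvalue A (\<gamma> + k) \<longleftrightarrow> eigenvalue A0 k" for k
    unfolding eigenvalue_def eigenvector_def dim using * by blast
  then show ?thesis
    unfolding spectrum_def
    by (auto simp: image_iff) (metis add.commute diff_add_cancel)
qed

text \<open>If \<open>P\<close> has the basis vectors as columns, then \<open>A * P = P * B\<close>
  carries an eigenvector \<open>v\<close> of \<open>B\<close> to \<open>P *\<^sub>v v\<close>, an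
  eigenvector of \<open>A\<close> for the same eigenvalue. It is nonzero because the columns of
  \<open>P\<close> are independent.\<close>

lemma represents_restriction_spectrum:
  assumes A: "A \<in> carrier_mat n n" and inv: "invariant_subspace n A V"
    and rep: "represents_restriction n A V B"
  shows "spectrum B \<subseteq> spectrum A"
proof
  interpret vs: vec_space "TYPE(complex)" n .
  obtain bs where bs: "distinct bs"
    and basis: "vectorspace.basis class_ring (subspace_module n V) (set bs)"
    and B: "B \<in> carrier_mat (length bs) (length bs)"
    and AP: "A * mat_of_cols n bs = mat_of_cols n bs * B"
    using rep unfolding represents_restriction_def by blast
  have sub: "VectorSpace.subspace class_ring V (module_vec TYPE(complex) n)"
    using inv unfolding invariant_subspace_def by auto
  have submod: "submodule class_ring V (module_vec TYPE(complex) n)"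
    using sub by (simp add: VectorSpace.subspace_def)
  interpret w: vectorspace class_ring "subspace_module n V"
    unfolding subspace_module_def by (rule vs.subspace_is_vs[OF sub])
  have bsV: "set bs \<subseteq> V" and li: "w.lin_indpt (set bs)"
    using basis unfolding w.basis_def by (auto simp: subspace_module_def)
  have "V \<subseteq> carrier_vec n"
    using submod unfolding submodule_def by (auto simp: module_vec_simps)
  then have bsn: "set bs \<subseteq> carrier_vec n" using bsV by auto
  \<comment> \<open>Independence inside the submodule agrees with independence in the ambient
    space.\<close>
  have li: "vs.lin_indpt (set bs)"
    using li vs.span_li_not_depend(2)[OF bsV submod] unfolding subspace_module_def by simp
  define P where "P = mat_of_cols n bs"
  have P: "P \<in> carrier_mat n (length bs)" unfolding P_def by simp
  have cols: "cols P = bs" unfolding P_def by (rule cols_mat_of_cols[OF bsn])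
  fix k assume "k \<in> spectrum B"
  then obtain v where v: "v \<in> carrier_vec (length bs)" "v \<noteq> 0\<^sub>v (length bs)"
    and Bv: "B *\<^sub>v v = k \<cdot>\<^sub>v v"
    using B unfolding spectrum_def eigenvalue_def eigenvector_def by auto
  \<comment> \<open>A nonzero kernel vector would be a linear relation among the columns; as
    \<open>bs\<close> is distinct, it is a relation in \<open>set bs\<close>.\<close>
  have nz: "P *\<^sub>v v \<noteq> 0\<^sub>v n"
    using vs.lin_depI[OF P v] bs li unfolding cols by blast
  have "A *\<^sub>v (P *\<^sub>v v) = (A * P) *\<^sub>v v" using A P v by simp
  also have "\<dots> = P *\<^sub>v (B *\<^sub>v v)"
    unfolding AP[folded P_def] by (rule assoc_mult_mat_vec[OF P B v(1)])
  also have "\<dots> = k \<cdot>\<^sub>v (P *\<^sub>v v)" unfolding Bv using P v by (simp add: mult_mat_vec)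
  finally show "k \<in> spectrum A"
    unfolding spectrum_def eigenvalue_def eigenvector_def using A P v nz
    by (auto intro!: exI[of _ "P *\<^sub>v v"])
qed

section \<open>The ellipse of a traceless matrix\<close>

text \<open>The mixed term of each square contains \<open>2 * Re (g x) * Im (g x)\<close>, which is
  the imaginary part of \<open>(g x)\<^sup>2\<close>. Hence the form is diagonal in
  \<open>Re p\<close> and \<open>Im p\<close> once the sum of these squares is real.\<close>

lemma sum_mset_Re_mult_square:
  fixes g :: "'a \<Rightarrow> complex"
  shows "(\<Sum>x\<in>#M. (Re (p * g x))\<^sup>2) = (Re p)\<^sup>2 * (\<Sum>x\<in>#M. (Re (g x))\<^sup>2) +
    (Im p)\<^sup>2 * (\<Sum>x\<in>#M. (Im (g x))\<^sup>2) - Re p * Im p * Im (\<Sum>x\<in>#M. (g x)\<^sup>2)"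
  by (induction M) (auto simp: algebra_simps power2_eq_square)

lemma sum_mset_Re_square_minus_Im_square:
  fixes g :: "'a \<Rightarrow> complex"
  shows "(\<Sum>x\<in>#M. (Re (g x))\<^sup>2) - (\<Sum>x\<in>#M. (Im (g x))\<^sup>2) = Re (\<Sum>x\<in>#M. (g x)\<^sup>2)"
  by (induction M) (auto simp: algebra_simps power2_eq_square)

lemma sum_mset_Re_square_plus_Im_square:
  fixes g :: "'a \<Rightarrow> complex"
  shows "(\<Sum>x\<in>#M. (Re (g x))\<^sup>2) + (\<Sum>x\<in>#M. (Im (g x))\<^sup>2) = (\<Sum>x\<in>#M. (cmod (g x))\<^sup>2)"
  by (induction M) (auto simp: algebra_simps cmod_power2)

text \<open>The condition on \<open>w\<close> also covers \<open>tr_sq A = 0\<close>: then every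
  unit number qualifies and the ellipse is a disk.\<close>

lemma trace_ellipse_semiaxes:
  assumes A: "A \<in> carrier_mat n n" and n: "n \<ge> 2" and tr: "mat_trace A = 0"
    and w: "cmod w = 1" "tr_sq A = of_real (cmod (tr_sq A)) * w\<^sup>2"
  defines "a \<equiv> ell_scale n * sqrt (\<Sum>x\<in>#eigvals_mset A. (Re (x * inverse w))\<^sup>2)"
    and "b \<equiv> ell_scale n * sqrt (\<Sum>x\<in>#eigvals_mset A. (Im (x * inverse w))\<^sup>2)"
  shows "is_trace_ellipse A 0 (trace_ellipse A) a b"
    and "trace_ellipse A \<subseteq> convex hull (spectrum A)"
proof -
  define s q M where "s = ell_scale n" and "q = cmod (tr_sq A)" and "M = eigvals_mset A"
  define c where "c = s * sqrt q"
  define E where "E = {z. cmod (z - of_real c * w) + cmod (z - - (of_real c * w)) \<le> 2 * a}"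
  \<comment> \<open>This identity is what cancels the constant in the final estimate.\<close>
  have s: "s > 0" "2 * (real n - 1)\<^sup>2 * s\<^sup>2 = 1"
    using n unfolding s_def ell_scale_def by (auto simp: power_divide power_mult_distrib)
  have w0: "w \<noteq> 0" using w by auto
  have dim: "dim_row A = n" using A by auto
  have nonneg: "0 \<le> (\<Sum>x\<in>#M. (f x)\<^sup>2)" for f :: "complex \<Rightarrow> real"
    by (intro sum_mset_nonneg_real) auto
  have a2: "a\<^sup>2 = s\<^sup>2 * (\<Sum>x\<in>#M. (Re (x * inverse w))\<^sup>2)"
    and b2: "b\<^sup>2 = s\<^sup>2 * (\<Sum>x\<in>#M. (Im (x * inverse w))\<^sup>2)"
    and ab: "0 \<le> a" "0 \<le> b"
    using nonneg s unfolding a_def b_def s_def[symmetric] M_def[symmetric]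
    by (simp_all add: power_mult_distrib)
  \<comment> \<open>The turned eigenvalues have a real sum of squares. This gives the focal distance
    and later removes the mixed term.\<close>
  have "(\<Sum>x\<in>#M. (x * inverse w)\<^sup>2) = (\<Sum>x\<in>#M. x\<^sup>2) * inverse (w\<^sup>2)"
    by (simp add: power_mult_distrib sum_mset_distrib_right power_inverse)
  also have "\<dots> = of_real q"
    using sum_sq_eigvals_mset[OF A] w(2) w0 unfolding M_def q_def by (simp add: field_simps)
  finally have q: "(\<Sum>x\<in>#M. (x * inverse w)\<^sup>2) = of_real q" .
  have "a\<^sup>2 - b\<^sup>2 = s\<^sup>2 * q"
    using sum_mset_Re_square_minus_Im_square[of "\<lambda>x. x * inverse w" M]
    unfolding a2 b2 q by (metis right_diff_distrib Re_complex_of_real)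
  then have diff: "a\<^sup>2 - b\<^sup>2 = c\<^sup>2"
    unfolding c_def by (simp add: power_mult_distrib q_def)
  have "a\<^sup>2 + b\<^sup>2 = s\<^sup>2 * (\<Sum>x\<in>#M. (cmod (x * inverse w))\<^sup>2)"
    using sum_mset_Re_square_plus_Im_square[of "\<lambda>x. x * inverse w" M]
    unfolding a2 b2 by (metis distrib_left)
  then have sum: "a\<^sup>2 + b\<^sup>2 = s\<^sup>2 * (\<Sum>x\<in>#M. (cmod x)\<^sup>2)"
    using w by (simp add: norm_mult norm_inverse)
  have "b\<^sup>2 \<le> a\<^sup>2" using diff zero_le_power2[of c] by linarith
  then have ba: "b \<le> a" using ab(1) by (rule power2_le_imp_le)
  have "cmod (of_real c * w - - (of_real c * w)) = cmod (of_real (2 * c) * w)"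
    by (rule arg_cong[of _ _ cmod]) simp
  also have "\<dots> = 2 * \<bar>c\<bar>" using w by (simp add: norm_mult)
  finally have foc: "cmod (of_real c * w - - (of_real c * w)) = 2 * \<bar>c\<bar>" .
  then have E: "is_ellipse E (of_real c * w) (- (of_real c * w)) a b"
    using ab ba diff unfolding is_ellipse_def E_def foc by (simp add: power_mult_distrib)
  \<comment> \<open>The other square root of \<open>tr_sq A\<close> exchanges the two foci.\<close>
  then have E': "is_ellipse E (- (of_real c * w)) (of_real c * w) a b"
    unfolding is_ellipse_def by (simp add: norm_minus_commute add.commute)
  have E_trace: "is_trace_ellipse A 0 E a b"
    unfolding is_trace_ellipse_def dim s_def[symmetric] M_def[symmetric]
  proof (intro conjI allI impI)
    fix r assume "r\<^sup>2 = tr_sq A"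
    also have "\<dots> = (of_real (sqrt q) * w)\<^sup>2"
      using w(2) by (simp add: power_mult_distrib q_def flip: of_real_power)
    finally have "r = of_real (sqrt q) * w \<or> r = - (of_real (sqrt q) * w)"
      by (rule power2_eq_iff[THEN iffD1])
    then show "is_ellipse E (0 + of_real s * r) (0 - of_real s * r) a b"
      using E E' unfolding c_def by (auto simp: mult.assoc)
  qed (rule sum)
  then show "is_trace_ellipse A 0 (trace_ellipse A) a b" by (simp add: trace_ellipse_eq)
  have "E \<subseteq> convex hull (spectrum A)"
  proof (rule subsetI, rule ccontr)
    fix z assume z: "z \<in> E" and notin: "z \<notin> convex hull (spectrum A)"
    have "compact (convex hull (spectrum A))"
      using card_finite_spectrum(1)[OF A] by (simp add: finite_imp_compact_convex_hull)
    then obtain u l where u: "inner u z < l" "\<forall>x\<in>convex hull (spectrum A). inner u x > l"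
      using separating_hyperplane_closed_point[OF _ _ notin] compact_imp_closed by auto
    \<comment> \<open>\<open>inner u x\<close> is \<open>Re (cnj u * x)\<close>; the sign turns the
      lower bound on the hull into an upper bound.\<close>
    define v L where "v = - cnj u" and "L = - l"
    have Re_v: "Re (v * x) = - inner u x" for x by (simp add: v_def inner_complex_def)
    have le: "Re (v * x) \<le> L" if "x \<in># M" for x
    proof -
      have "x \<in> convex hull (spectrum A)"
        using that hull_inc set_eigvals_mset[OF A] unfolding M_def by auto
      then have "l < inner u x" using u(2) by blast
      then show ?thesis by (simp only: Re_v L_def neg_le_iff_le less_imp_le)
    qed
    have zL: "L < Re (v * z)" using u(1) by (simp only: Re_v L_def neg_less_iff_less)
    have size: "size M = n" unfolding M_def by (rule size_eigvals_mset[OF A])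
    have "(\<Sum>x\<in>#N. Re (v * x)) = Re (v * (\<Sum>x\<in>#N. x))" for N
      by (induction N) (auto simp: distrib_left simp del: times_complex.sel)
    then have zero: "(\<Sum>x\<in>#M. Re (v * x)) = 0"
      by (simp only: M_def sum_eigvals_mset[OF A] tr mult_zero_right zero_complex.sel)
    \<comment> \<open>Nonnegativity of \<open>L\<close> allows passing from squares to
      \<open>Re (v * z) \<le> L\<close> at the end.\<close>
    have "0 \<le> real n * L"
      using sum_mset_le_size_mult[of M "\<lambda>x. Re (v * x)", OF le] unfolding zero size .
    then have L: "0 \<le> L" using n by (simp add: zero_le_mult_iff)
    have bound: "(\<Sum>x\<in>#M. (Re (v * x))\<^sup>2) \<le> real n * (real n - 1) * L\<^sup>2"
      using sum_mset_squares_le_of_upper_bound[of M "\<lambda>x. Re (v * x)" L] le zero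
      unfolding size by blast
    have vwx: "v * w * (x * inverse w) = v * x" for x using w0 by (simp add: field_simps)
    have "(Re (v * z))\<^sup>2 \<le> a\<^sup>2 * (Re (v * w))\<^sup>2 + b\<^sup>2 * (Im (v * w))\<^sup>2"
      by (rule ellipse_support[OF E w(1) z])
    \<comment> \<open>The quadratic form is evaluated at \<open>p = v * w\<close> on the turned
      eigenvalues, where it has no mixed term.\<close>
    also have "\<dots> = s\<^sup>2 * (\<Sum>x\<in>#M. (Re (v * w * (x * inverse w)))\<^sup>2)"
      unfolding sum_mset_Re_mult_square q a2 b2
      by (simp only: Im_complex_of_real mult_zero_left mult_zero_right diff_0_right distrib_left mult_ac)
    also have "\<dots> = s\<^sup>2 * (\<Sum>x\<in>#M. (Re (v * x))\<^sup>2)" by (simp only: vwx)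
    also have "\<dots> \<le> s\<^sup>2 * (real n * (real n - 1) * L\<^sup>2)"
      by (rule mult_left_mono[OF bound zero_le_power2])
    also have "\<dots> \<le> s\<^sup>2 * (2 * (real n - 1)\<^sup>2 * L\<^sup>2)"
    proof (intro mult_left_mono mult_right_mono)
      \<comment> \<open>\<open>n \<le> 2 * (n - 1)\<close> is the assumption
        \<open>n \<ge> 2\<close>.\<close>
      have "real n * (real n - 1) \<le> (2 * (real n - 1)) * (real n - 1)"
        using n by (intro mult_right_mono) auto
      then show "real n * (real n - 1) \<le> 2 * (real n - 1)\<^sup>2" by (simp only: power2_eq_square mult.assoc)
    qed auto
    also have "\<dots> = 2 * (real n - 1)\<^sup>2 * s\<^sup>2 * L\<^sup>2" by (simp only: mult_ac)
    also have "\<dots> = L\<^sup>2" by (simp only: s(2) mult_1_left)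
    finally have "Re (v * z) \<le> L" using L by (rule power2_le_imp_le)
    then show False using zL by simp
  qed
  then show "trace_ellipse A \<subseteq> convex hull (spectrum A)"
    using trace_ellipse_eq[OF E_trace] by simp
qed

section \<open>Choice of \<open>w\<close> and translation to a general centre\<close>

lemma unit_square_root_exists: "\<exists>w. cmod w = 1 \<and> z = of_real (cmod z) * w\<^sup>2"
proof (cases "z = 0")
  case True
  then show ?thesis by (intro exI[of _ 1]) simp
next
  case False
  have "(cmod (csqrt (sgn z)))\<^sup>2 = 1" using False by (simp add: norm_sgn flip: norm_power)
  moreover have "z = of_real (cmod z) * (csqrt (sgn z))\<^sup>2"
    using False by (simp add: sgn_eq)
  ultimately show ?thesis by (intro exI[of _ "csqrt (sgn z)"]) (simp add: power2_eq_1_iff)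
qed

lemma is_trace_ellipse_translate:
  assumes "is_trace_ellipse A 0 E a b"
  shows "is_trace_ellipse A \<gamma> ((\<lambda>z. \<gamma> + z) ` E) a b"
proof -
  have "is_ellipse ((\<lambda>z. \<gamma> + z) ` E) (\<gamma> + f) (\<gamma> - f) a b" if "is_ellipse E f (- f) a b" for f
  proof -
    have E: "E = {z. cmod (z - f) + cmod (z + f) \<le> 2 * a}" using that by (simp add: is_ellipse_def)
    have "(\<lambda>z. \<gamma> + z) ` E = {z. cmod (z - (\<gamma> + f)) + cmod (z - (\<gamma> - f)) \<le> 2 * a}"
    proof (intro subset_antisym subsetI)
      fix z assume "z \<in> {z. cmod (z - (\<gamma> + f)) + cmod (z - (\<gamma> - f)) \<le> 2 * a}"
      then have "z - \<gamma> \<in> E" by (simp add: E algebra_simps)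
      then show "z \<in> (\<lambda>z. \<gamma> + z) ` E" by (intro image_eqI[of _ _ "z - \<gamma>"]) auto
    qed (auto simp: E)
    then show ?thesis using that unfolding is_ellipse_def by simp
  qed
  then show ?thesis using assms unfolding is_trace_ellipse_def by simp
qed

text \<open>Taking convex hulls commutes with translation, so the traceless case is shifted by
  \<open>\<gamma>\<close>. The lemma serves both the full matrix and, in dimension \<open>m\<close>,
  its restrictions.\<close>

lemma shifted_trace_ellipse:
  assumes n: "n \<ge> 2" and dec: "traceless_decomp n A \<gamma> A0"
  shows "(\<lambda>z. \<gamma> + z) ` trace_ellipse A0 \<subseteq> convex hull (spectrum A)"
    and "\<exists>a b. is_trace_ellipse A0 \<gamma> ((\<lambda>z. \<gamma> + z) ` trace_ellipse A0) a b"
proof -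
  have A0: "A0 \<in> carrier_mat n n" "mat_trace A0 = 0"
    using dec unfolding traceless_decomp_def by auto
  obtain w where w: "cmod w = 1" "tr_sq A0 = of_real (cmod (tr_sq A0)) * w\<^sup>2"
    using unit_square_root_exists by blast
  note * = trace_ellipse_semiaxes[OF A0(1) n A0(2) w]
  show "\<exists>a b. is_trace_ellipse A0 \<gamma> ((\<lambda>z. \<gamma> + z) ` trace_ellipse A0) a b"
    using is_trace_ellipse_translate[OF *(1)] by blast
  show "(\<lambda>z. \<gamma> + z) ` trace_ellipse A0 \<subseteq> convex hull (spectrum A)"
    unfolding spectrum_traceless_decomp[OF dec] convex_hull_translation
    using *(2) by (rule image_mono)
qed

theorem theorem1:
  fixes n :: nat
  assumes "n \<ge> 2"
  shows
    "(\<forall>A0 \<in> carrier_mat n n. mat_trace A0 = 0 \<longrightarrow>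
        trace_ellipse A0 \<subseteq> convex hull (spectrum A0) \<and>
        (\<exists>a b. is_trace_ellipse A0 0 (trace_ellipse A0) a b \<and>
           (tr_sq A0 \<noteq> 0 \<longrightarrow>
             (\<forall>w. w\<^sup>2 = tr_sq A0 / of_real (cmod (tr_sq A0)) \<longrightarrow>
                a = ell_scale n * sqrt (\<Sum>x\<in>#eigvals_mset A0. (Re (x * inverse w))\<^sup>2) \<and>
                b = ell_scale n * sqrt (\<Sum>x\<in>#eigvals_mset A0. (Im (x * inverse w))\<^sup>2)))))
     \<and>
     (\<forall>A \<in> carrier_mat n n.
        (\<forall>\<gamma> A0. traceless_decomp n A \<gamma> A0 \<longrightarrow>
           (\<lambda>z. \<gamma> + z) ` trace_ellipse A0 \<subseteq> convex hull (spectrum A) \<and>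
           (\<exists>a b. is_trace_ellipse A0 \<gamma> ((\<lambda>z. \<gamma> + z) ` trace_ellipse A0) a b)) \<and>
        (\<forall>V m B \<delta> B0.
           invariant_subspace n A V \<and>
           vectorspace.dim class_ring (subspace_module n V) = m \<and> m \<ge> 2 \<and>
           B \<in> carrier_mat m m \<and> represents_restriction n A V B \<and>
           traceless_decomp m B \<delta> B0 \<longrightarrow>
           (\<lambda>z. \<delta> + z) ` trace_ellipse B0 \<subseteq> convex hull (spectrum A) \<and>
           (\<exists>a b. is_trace_ellipse B0 \<delta> ((\<lambda>z. \<delta> + z) ` trace_ellipse B0) a b)))"

proof (intro conjI ballI allI impI; (elim conjE)?)
  fix A0 assume A0: "A0 \<in> carrier_mat n n" "mat_trace A0 = 0"
  show "trace_ellipse A0 \<subseteq> convex hull (spectrum A0)"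
    using unit_square_root_exists trace_ellipse_semiaxes(2)[OF A0(1) assms A0(2)] by blast
  show "\<exists>a b. is_trace_ellipse A0 0 (trace_ellipse A0) a b \<and>
           (tr_sq A0 \<noteq> 0 \<longrightarrow>
             (\<forall>w. w\<^sup>2 = tr_sq A0 / of_real (cmod (tr_sq A0)) \<longrightarrow>
                a = ell_scale n * sqrt (\<Sum>x\<in>#eigvals_mset A0. (Re (x * inverse w))\<^sup>2) \<and>
                b = ell_scale n * sqrt (\<Sum>x\<in>#eigvals_mset A0. (Im (x * inverse w))\<^sup>2)))"
  proof -
    obtain w0 where w0: "cmod w0 = 1" "tr_sq A0 = of_real (cmod (tr_sq A0)) * w0\<^sup>2"
      using unit_square_root_exists by blast
    \<comment> \<open>The witnesses \<open>a\<close> and \<open>b\<close> are fixed through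
      \<open>w0\<close> before \<open>w\<close> is quantified, so every admissible \<open>w\<close>
      is compared with \<open>w0\<close>.\<close>
    have pm: "w = w0 \<or> w = - w0"
      if "tr_sq A0 \<noteq> 0" "w\<^sup>2 = tr_sq A0 / of_real (cmod (tr_sq A0))" for w
    proof -
      have "w\<^sup>2 = w0\<^sup>2" using that arg_cong[OF w0(2), of "\<lambda>z. z / of_real (cmod (tr_sq A0))"] by simp
      then show ?thesis by (rule power2_eq_iff[THEN iffD1])
    qed
    note E = trace_ellipse_semiaxes(1)[OF A0(1) assms A0(2) w0]
    show ?thesis
    proof (rule exI, rule exI, rule conjI, rule E, intro impI allI)
      fix w assume "tr_sq A0 \<noteq> 0" "w\<^sup>2 = tr_sq A0 / of_real (cmod (tr_sq A0))"
      then have "w = w0 \<or> w = - w0" by (rule pm)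
      then show "ell_scale n * sqrt (\<Sum>x\<in>#eigvals_mset A0. (Re (x * inverse w0))\<^sup>2) =
          ell_scale n * sqrt (\<Sum>x\<in>#eigvals_mset A0. (Re (x * inverse w))\<^sup>2) \<and>
        ell_scale n * sqrt (\<Sum>x\<in>#eigvals_mset A0. (Im (x * inverse w0))\<^sup>2) =
          ell_scale n * sqrt (\<Sum>x\<in>#eigvals_mset A0. (Im (x * inverse w))\<^sup>2)"
        \<comment> \<open>Replacing \<open>w0\<close> by \<open>- w0\<close> only changes signs
          under the squares.\<close>
        by (auto simp: inverse_minus_eq simp del: inverse_complex.sel times_complex.sel)
    qed
  qed
next
  fix A \<gamma> A0 assume dec: "traceless_decomp n A \<gamma> A0"
  show "(\<lambda>z. \<gamma> + z) ` trace_ellipse A0 \<subseteq> convex hull (spectrum A)"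
    by (rule shifted_trace_ellipse(1)[OF assms dec])
  show "\<exists>a b. is_trace_ellipse A0 \<gamma> ((\<lambda>z. \<gamma> + z) ` trace_ellipse A0) a b"
    by (rule shifted_trace_ellipse(2)[OF assms dec])
next
  fix A V m B \<delta> B0
  assume A: "A \<in> carrier_mat n n" and V: "invariant_subspace n A V"
    and m: "2 \<le> m" and B: "represents_restriction n A V B" and dec: "traceless_decomp m B \<delta> B0"
  \<comment> \<open>Eigenvalues of the restriction are eigenvalues of \<open>A\<close>, so
    containment for \<open>B\<close> passes to the larger hull.\<close>
  have "convex hull (spectrum B) \<subseteq> convex hull (spectrum A)"
    using represents_restriction_spectrum[OF A V B] by (rule hull_mono)
  then show "(\<lambda>z. \<delta> + z) ` trace_ellipse B0 \<subseteq> convex hull (spectrum A)"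
    using shifted_trace_ellipse(1)[OF m dec] by blast
  show "\<exists>a b. is_trace_ellipse B0 \<delta> ((\<lambda>z. \<delta> + z) ` trace_ellipse B0) a b"
    by (rule shifted_trace_ellipse(2)[OF m dec])
qed

end
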